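(* Let $\theta\in(0,\tfrac12)$ and let $n$ be a positive integer with $n>\theta^{-8/\theta}$. For at least a proportion $1-e^{-n}$ of the permutations $\pi\in S_n$ (i.e. for at least $(1-e^{-n})\,n!$ of them), the following holds: any tangle performing $\pi$ has either at least $(\tfrac12-\theta)n$ clusters or at least $\tfrac16\theta n\log n$ corners.
   Context: $S_n$ is the symmetric group on $\{1,\ldots,n\}$; a permutation is written $\pi=[\pi(1),\ldots,\pi(n)]$, and $\mathrm{id}=[1,\ldots,n]$; $\log$ is the natural logarithm. Two permutations $\pi,\rho\in S_n$ are adjacent if $|\pi^{-1}(i)-\rho^{-1}(i)|\le 1$ for every $i\in\{1,\ldots,n\}$. A tangle is a finite sequence $\pi_1,\ldots,\pi_N$ of permutations in $S_n$ in which each consecutive pair is adjacent. A tangle performs $\pi$ if its first permutation is $\mathrm{id}$ and its last is $\pi$. Corners: by convention it is assumed that the initial and the final permutation of the tangle are each repeated at least once (so $\pi_1=\pi_2$ and $\pi_{N-1}=\pi_N$). Place the $k$th element $\pi_t(k)$ of the $t$th permutation at the point $(k-\tfrac12,\,t-\tfrac12)$. For an element $i$, path $i$ is the polygonal path joining the successive locations of $i$; each of its steps has direction $\pi_{t+1}^{-1}(i)-\pi_t^{-1}(i)\in\{-1,0,+1\}$. A corner is a vertex of a path (a location of an element $i$ at a time $t$ with $1<t<N$) at which the direction of the incoming step differs from that of the outgoing step. When counting the number of corners, a corner at which the direction changes between $+1$ and $-1$ (in either order) is counted with multiplicity $2$, and every other corner with multiplicity $1$. Clusters: consider the graph whose vertices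 are the corners of the tangle, with an edge between two corners if their locations are within $\ell^\infty$-distance $1$. The clusters of the tangle are the connected components of this graph. *)

theory Defs
  imports "HOL-Analysis.Analysis" "HOL-Combinatorics.Permutations"
begin

text \<open>
  A permutation \<open>[\<pi>(1), \<dots>, \<pi>(n)]\<close> is a function with \<open>\<pi> permutes {1..n}\<close>; \<open>\<pi> k\<close> is the element
  at position \<open>k\<close>, so \<open>inv \<pi> i\<close> is the position of element \<open>i\<close>.
\<close>

definition adjacent :: "nat \<Rightarrow> (nat \<Rightarrow> nat) \<Rightarrow> (nat \<Rightarrow> nat) \<Rightarrow> bool" where
  "adjacent n \<pi> \<rho> \<longleftrightarrow> (\<forall>i\<in>{1..n}. \<bar>int (inv \<pi> i) - int (inv \<rho> i)\<bar> \<le> 1)"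

text \<open>
  Lists are indexed from 0, so the sequence \<open>\<pi>\<^sub>1, \<dots>, \<pi>\<^sub>N\<close> is \<open>T ! 0, \<dots>, T ! (N - 1)\<close>
  with \<open>N = length T\<close>.
\<close>

definition tangle :: "nat \<Rightarrow> (nat \<Rightarrow> nat) list \<Rightarrow> bool" where
  "tangle n T \<longleftrightarrow> T \<noteq> [] \<and> (\<forall>\<pi>\<in>set T. \<pi> permutes {1..n}) \<and>
     (\<forall>t. t + 1 < length T \<longrightarrow> adjacent n (T ! t) (T ! (t + 1)))"

definition performs :: "nat \<Rightarrow> (nat \<Rightarrow> nat) list \<Rightarrow> (nat \<Rightarrow> nat) \<Rightarrow> bool" where
  "performs n T \<pi> \<longleftrightarrow> tangle n T \<and> hd T = id \<and> last T = \<pi>"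

text \<open>
  The standing convention for corners and clusters: the initial and the final permutation are
  each repeated, so that no direction change is lost at either end.
\<close>

definition repeated_ends :: "(nat \<Rightarrow> nat) list \<Rightarrow> bool" where
  "repeated_ends T \<longleftrightarrow> 2 \<le> length T \<and> T ! 0 = T ! 1 \<and>
     T ! (length T - 2) = T ! (length T - 1)"

definition direction :: "(nat \<Rightarrow> nat) list \<Rightarrow> nat \<Rightarrow> nat \<Rightarrow> int" where
  "direction T i t = int (inv (T ! (t + 1)) i) - int (inv (T ! t) i)"

text \<open>
  A vertex of a path is encoded as a pair \<open>(i, t)\<close> of an element and a list index.  In the
  1-based numbering its time is \<open>t + 1\<close>, so its height \<open>(t + 1) - 1/2\<close> becomes \<open>t + 1/2\<close>.
\<close>

definition location :: "(nat \<Rightarrow> nat) list \<Rightarrow> nat \<times> nat \<Rightarrow> real \<times> real" where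
  "location T = (\<lambda>(i, t). (real (inv (T ! t) i) - 1/2, real t + 1/2))"

definition corners :: "nat \<Rightarrow> (nat \<Rightarrow> nat) list \<Rightarrow> (nat \<times> nat) set" where
  "corners n T = {(i, t). i \<in> {1..n} \<and> 0 < t \<and> t + 1 < length T \<and>
     direction T i (t - 1) \<noteq> direction T i t}"

definition multiplicity_of_corner :: "(nat \<Rightarrow> nat) list \<Rightarrow> nat \<times> nat \<Rightarrow> nat" where
  "multiplicity_of_corner T =
     (\<lambda>(i, t). if {direction T i (t - 1), direction T i t} = {1, -1} then 2 else 1)"

definition num_corners :: "nat \<Rightarrow> (nat \<Rightarrow> nat) list \<Rightarrow> nat" where
  "num_corners n T = (\<Sum>c\<in>corners n T. multiplicity_of_corner T c)"

text \<open>The library function \<open>infnorm\<close> is the sup norm on \<open>real \<times> real\<close>.\<close>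

definition corner_edges :: "nat \<Rightarrow> (nat \<Rightarrow> nat) list \<Rightarrow> ((nat \<times> nat) \<times> (nat \<times> nat)) set" where
  "corner_edges n T = {(c, d). c \<in> corners n T \<and> d \<in> corners n T \<and>
     infnorm (location T c - location T d) \<le> 1}"

definition clusters :: "nat \<Rightarrow> (nat \<Rightarrow> nat) list \<Rightarrow> (nat \<times> nat) set set" where
  "clusters n T = corners n T // (corner_edges n T)\<^sup>*"

lemma finite_corners: "finite (corners n T)"
  by (rule finite_subset[of _ "{1..n} \<times> {..<length T}"]) (auto simp: corners_def)

lemma infnorm_prod: "infnorm (x :: real \<times> real) = max \<bar>fst x\<bar> \<bar>snd x\<bar>"
proof -
  have "{\<bar>x \<bullet> b\<bar> |b. b \<in> Basis} = {\<bar>fst x\<bar>, \<bar>snd x\<bar>}"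
    by (cases x) (auto simp: Basis_prod_def; force)
  then show ?thesis
    by (simp add: infnorm_def cSup_eq_Max)
qed

lemma equiv_corner_edges: "equiv UNIV ((corner_edges n T)\<^sup>*)"
proof (rule equivI)
  have "sym (corner_edges n T)"
    by (auto simp: sym_def corner_edges_def infnorm_sub)
  then show "sym ((corner_edges n T)\<^sup>*)"
    by (rule sym_rtrancl)
qed (auto simp: refl_rtrancl trans_rtrancl)

lemma clusters_subset: "C \<in> clusters n T \<Longrightarrow> C \<subseteq> corners n T"
proof -
  have "(c, d) \<in> (corner_edges n T)\<^sup>* \<Longrightarrow> c \<in> corners n T \<Longrightarrow> d \<in> corners n T" for c d
    by (induction rule: rtrancl_induct) (auto simp: corner_edges_def)
  then show "C \<in> clusters n T \<Longrightarrow> C \<subseteq> corners n T"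
    by (auto simp: clusters_def quotient_def)
qed

end

theory Submission imports Defs begin

text \<open>
  Count the permutations that some tangle with fewer than \<open>K = (1/2 - \<theta>) n\<close> clusters and fewer than
  \<open>M = \<theta> n log n / 6\<close> corners performs.  A tangle is determined by the locations of its corners
  together with the outgoing directions there.  In a shortest such tangle no four consecutive
  permutations agree, and a path that moves without corner leaves \<open>{1..n}\<close> within \<open>n\<close> steps, so the
  length is at most \<open>n (M + 1)\<close>.  Hence one representative per cluster can be
  chosen in at most \<open>(e n\<^sup>2 (M + 1) / K)\<^sup>K\<close> ways, and each further corner is found by exploring the
  clusters from the representatives, at a cost of 3 labels and \<open>2\<^sup>9\<close> sets of neighbours per corner.
  The unordered set of representatives thus costs about \<open>n\<^bsup>2K\<^esup> = n\<^bsup>(1 - 2\<theta>) n\<^esup>\<close>, and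
  \<open>1536\<^sup>M\<close> costs less than the remaining \<open>n\<^bsup>2 \<theta> n\<^esup>\<close>, with room for the factor \<open>e\<^bsup>-2n\<^esup>\<close>.
\<close>

subsection \<open>Tangles are determined by their corners\<close>

text \<open>The location translated to integer coordinates. Differences of locations are unchanged,
  and sites lie in the abelian group \<open>int \<times> int\<close>, as \<open>explore\<close>
  requires.\<close>

definition site :: "(nat \<Rightarrow> nat) list \<Rightarrow> nat \<times> nat \<Rightarrow> int \<times> int" where
  "site T = (\<lambda>(i, t). (int (inv (T ! t) i), int t))"

text \<open>
  Only the outgoing direction at a corner is recorded: the incoming one is known from the past.
\<close>
definition corner_labels :: "nat \<Rightarrow> (nat \<Rightarrow> nat) list \<Rightarrow> ((int \<times> int) \<times> int) set" where
  "corner_labels n T = (\<lambda>c. (site T c, case_prod (direction T) c)) ` corners n T"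

text \<open>
  In \<open>R\<close> every cluster has at least one representative, so \<open>K\<close> bounds the number of clusters.
\<close>
definition sparse_tangle :: "nat \<Rightarrow> real \<Rightarrow> real \<Rightarrow> (nat \<Rightarrow> nat) list \<Rightarrow> bool" where
  "sparse_tangle n K M T \<longleftrightarrow> tangle n T \<and> hd T = id \<and> repeated_ends T \<and>
     real (card (corners n T)) \<le> M \<and>
     (\<exists>R\<subseteq>corners n T. real (card R) \<le> K \<and> corners n T \<subseteq> (corner_edges n T)\<^sup>* `` R)"

section \<open>Positions, directions and sites in a tangle\<close>

lemma tangle_permutes: "tangle n T \<Longrightarrow> t < length T \<Longrightarrow> T ! t permutes {1..n}"
  by (auto simp: tangle_def)

lemma tangle_inv_inject:
  assumes "tangle n T" "t < length T"
  shows "inv (T ! t) i = inv (T ! t) j \<longleftrightarrow> i = j"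
  using permutes_inj[OF permutes_inv[OF tangle_permutes[OF assms]]] by (auto dest: injD)

lemma inv_in_range_iff: "p permutes {1..n} \<Longrightarrow> inv p i \<in> {1..n} \<longleftrightarrow> i \<in> {1..n}"
  by (rule permutes_in_image[OF permutes_inv])

lemma permutes_eqI_inv:
  assumes "p permutes {1..n}" "q permutes {1..n}" "\<And>i. i \<in> {1..n} \<Longrightarrow> inv p i = inv q i"
  shows "p = q"
proof -
  have "inv p i = inv q i" for i
    using assms(3)[of i] permutes_inv[OF assms(1)] permutes_inv[OF assms(2)]
    by (cases "i \<in> {1..n}") (simp_all add: permutes_def)
  then have "inv p = inv q" by (rule ext)
  then show ?thesis
    by (metis assms(1,2) permutes_inv_inv)
qed

lemma direction_range:
  assumes "tangle n T" "t + 1 < length T" "i \<in> {1..n}"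
  shows "direction T i t \<in> {-1, 0, 1}"
proof -
  have "\<bar>int (inv (T ! t) i) - int (inv (T ! (t + 1)) i)\<bar> \<le> 1"
    using assms by (auto simp: tangle_def adjacent_def)
  then show ?thesis by (auto simp: direction_def)
qed

lemma direction_eq_0_iff:
  assumes "tangle n T" "t + 1 < length T"
  shows "(\<forall>i\<in>{1..n}. direction T i t = 0) \<longleftrightarrow> T ! (t + 1) = T ! t"
proof
  assume "\<forall>i\<in>{1..n}. direction T i t = 0"
  then show "T ! (t + 1) = T ! t"
    using assms by (intro permutes_eqI_inv[OF tangle_permutes tangle_permutes])
      (auto simp: direction_def)
qed (simp add: direction_def)

lemma site_inject:
  assumes "tangle n T" "c \<in> corners n T" "d \<in> corners n T" "site T c = site T d"
  shows "c = d"
  using assms tangle_inv_inject[OF assms(1)] by (auto simp: site_def corners_def)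

text \<open>Between integer points, sup distance at most 1 leaves nine possible offsets; hence the
  \<open>2^9\<close> sets of neighbours in the code.\<close>

lemma infnorm_location_le_1_iff:
  "infnorm (location T c - location T d) \<le> 1 \<longleftrightarrow> site T c - site T d \<in> {-1..1} \<times> {-1..1}"
proof -
  have "infnorm (location T c - location T d) =
      of_int (max \<bar>fst (site T c - site T d)\<bar> \<bar>snd (site T c - site T d)\<bar>)"
    by (cases c; cases d) (simp add: infnorm_prod location_def site_def)
  then show ?thesis
    by (simp add: mem_Times_iff abs_le_iff) linarith
qed

lemma direction_step:
  assumes "(i, Suc t) \<notin> corners n T" "i \<in> {1..n}" "Suc (Suc t) < length T"
  shows "direction T i (Suc t) = direction T i t"
  using assms by (auto simp: corners_def)

text \<open>An element with a corner at time \<open>Suc t\<close> is recognised by its site, and its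
  label gives the next direction; any other element keeps its previous direction, which the two
  known rows determine.\<close>

lemma corner_labels_determine_step:
  assumes T: "tangle n T" "Suc (Suc t) < length T" and U: "tangle n U" "Suc (Suc t) < length U"
    and D: "corner_labels n T = corner_labels n U"
    and eq: "T ! t = U ! t" "T ! Suc t = U ! Suc t"
  shows "T ! Suc (Suc t) = U ! Suc (Suc t)"
proof (rule permutes_eqI_inv[OF tangle_permutes[OF T] tangle_permutes[OF U]])
  fix i assume i: "i \<in> {1..n}"
  have transfer: "direction V i (Suc t) = direction W i (Suc t) \<and> (i, Suc t) \<in> corners n W"
    if labels: "corner_labels n V = corner_labels n W" and "V ! Suc t = W ! Suc t"
      "(i, Suc t) \<in> corners n V" "tangle n W" "Suc t < length W" for V W
  proof -
    have "(site V (i, Suc t), direction V i (Suc t)) \<in> corner_labels n V"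
      using that(3) unfolding corner_labels_def by force
    then obtain j s where "(j, s) \<in> corners n W" "site V (i, Suc t) = site W (j, s)"
      "direction V i (Suc t) = direction W j s"
      unfolding labels unfolding corner_labels_def by auto
    moreover from this have "s = Suc t" by (simp add: site_def)
    ultimately show ?thesis
      using that(2) tangle_inv_inject[OF that(4,5)] by (auto simp: site_def)
  qed
  have "direction T i (Suc t) = direction U i (Suc t)"
  proof (cases "(i, Suc t) \<in> corners n T")
    case True
    then show ?thesis using transfer[of T U] D eq U by auto
  next
    case False
    then have "(i, Suc t) \<notin> corners n U" using transfer[of U T] D eq T by auto
    then have "direction U i (Suc t) = direction U i t" using direction_step i U(2) by blast
    moreover have "direction T i (Suc t) = direction T i t" using direction_step i T(2) False by blast
    ultimately show ?thesis using eq by (simp add: direction_def)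
  qed
  then show "inv (T ! Suc (Suc t)) i = inv (U ! Suc (Suc t)) i"
    using eq by (simp add: direction_def)
qed

text \<open>The repeated first permutation supplies the two rows from which the step lemma
  reconstructs both tangles in parallel, until the shorter one ends.\<close>

lemma corner_labels_determine_aux:
  assumes T: "tangle n T" "hd T = id" "repeated_ends T"
    and U: "tangle n U" "hd U = id" "repeated_ends U"
    and D: "corner_labels n T = corner_labels n U"
    and len: "length T \<le> length U"
  shows "last T = last U"
proof -
  have ne: "T \<noteq> []" "U \<noteq> []" using T U by (auto simp: tangle_def)
  have common: "t + 1 < length T \<Longrightarrow> T ! t = U ! t \<and> T ! Suc t = U ! Suc t" for t
  proof (induction t)
    case 0
    then show ?case using T U ne by (auto simp: repeated_ends_def hd_conv_nth)
  next
    case (Suc t)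
    then show ?case
      using corner_labels_determine_step[OF T(1) _ U(1) _ D, of t] len by simp
  qed
  obtain m where m: "length T = Suc (Suc m)"
    using T(3) by (metis repeated_ends_def Suc_le_D numeral_2_eq_2 Suc_le_mono)
  have "T ! m = T ! Suc m" using T(3) m by (simp add: repeated_ends_def)
  then have start: "U ! m = U ! Suc m" "U ! Suc m = T ! Suc m" using common[of m] m by auto
  \<comment> \<open>\<open>T\<close> ends at rest and has no corners from time \<open>Suc m\<close>
    on. By equality of the labels neither has \<open>U\<close>, which therefore stays at
    rest.\<close>
  have "Suc m + k < length U \<Longrightarrow> U ! (m + k) = T ! Suc m \<and> U ! (Suc m + k) = T ! Suc m" for k
  proof (induction k)
    case 0
    then show ?case using start by simp
  next
    case (Suc k)
    then have IH: "U ! (m + k) = T ! Suc m" "U ! (Suc m + k) = T ! Suc m" by auto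
    have "direction U i (Suc (m + k)) = 0" if i: "i \<in> {1..n}" for i
    proof -
      have "(i, Suc (m + k)) \<notin> corners n U"
      proof
        assume "(i, Suc (m + k)) \<in> corners n U"
        then have "(site U (i, Suc (m + k)), direction U i (Suc (m + k))) \<in> corner_labels n U"
          unfolding corner_labels_def by force
        then show False
          unfolding D[symmetric] by (auto simp: corner_labels_def site_def corners_def m)
      qed
      then have "direction U i (Suc (m + k)) = direction U i (m + k)"
        using direction_step i Suc.prems by simp
      then show ?thesis using IH by (simp add: direction_def)
    qed
    then have "U ! (Suc (m + k) + 1) = U ! Suc (m + k)"
      using direction_eq_0_iff[OF U(1), of "Suc (m + k)"] Suc.prems by auto
    then show ?case using IH by simp
  qed
  moreover obtain k where "length U = Suc (Suc m) + k"
    using len m by (metis le_Suc_ex)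
  ultimately show ?thesis
    using m ne by (simp add: last_conv_nth)
qed

lemma corner_labels_determine:
  assumes "tangle n T" "hd T = id" "repeated_ends T" "tangle n U" "hd U = id" "repeated_ends U"
    and "corner_labels n T = corner_labels n U"
  shows "last T = last U"
proof (cases "length T \<le> length U")
  case True
  then show ?thesis using corner_labels_determine_aux[OF assms] by simp
next
  case False
  then show ?thesis using corner_labels_determine_aux[OF assms(4-6,1-3) assms(7)[symmetric]] by simp
qed

subsection \<open>Shortening tangles\<close>

text \<open>Sends a vertex of the shortened tangle to the original one; its times skip
  \<open>Suc a\<close>, the row that \<open>delete_row a\<close> removes.\<close>

definition shift :: "nat \<Rightarrow> nat \<times> nat \<Rightarrow> nat \<times> nat" where
  "shift a = (\<lambda>(i, t). (i, if t \<le> a then t else Suc t))"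

definition delete_row :: "nat \<Rightarrow> 'a list \<Rightarrow> 'a list" where
  "delete_row a T = take (Suc a) T @ drop (Suc (Suc a)) T"

lemma nth_delete_row:
  assumes "Suc a < length T" "Suc t < length T"
  shows "delete_row a T ! t = T ! (if t \<le> a then t else Suc t)"
  using assms by (auto simp: delete_row_def nth_append)

lemma length_delete_row: "Suc a < length T \<Longrightarrow> length (delete_row a T) = length T - 1"
  by (simp add: delete_row_def)

lemma inj_shift: "inj (shift a)"
  by (auto simp: inj_def shift_def split: if_splits)

text \<open>
  With four equal rows, corners before and after the deleted row keep a time distance of at least 2,
  so clusters do not merge.
\<close>
lemma sparse_delete_row:
  assumes T: "sparse_tangle n K M T" and a: "a + 3 < length T"
    and eq: "T ! Suc a = T ! a" "T ! Suc (Suc a) = T ! a" "T ! Suc (Suc (Suc a)) = T ! a"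
  shows "sparse_tangle n K M (delete_row a T) \<and> last (delete_row a T) = last T"
proof -
  define U where "U = delete_row a T"
  have len: "length U = length T - 1" using a by (simp add: U_def length_delete_row)
  have nth: "U ! t = T ! (if t \<le> a then t else Suc t)" if "t < length U" for t
    using a that unfolding U_def by (intro nth_delete_row) (auto simp: length_delete_row)
  have tangT: "tangle n T" and repT: "repeated_ends T" and hdT: "hd T = id"
    using T by (auto simp: sparse_tangle_def)
  have dir: "direction U i t = direction T i (if t \<le> a then t else Suc t)" if "t + 1 < length U" for i t
    using nth[of t] nth[of "Suc t"] that eq
    by (cases "t < a"; cases "t = a") (auto simp: direction_def)
  have dir0: "direction T i a = 0" "direction T i (Suc a) = 0" "direction T i (Suc (Suc a)) = 0" for i
    using eq by (auto simp: direction_def)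
  have corner_iff: "c \<in> corners n U \<longleftrightarrow> shift a c \<in> corners n T" for c
  proof (cases c)
    case (Pair i t)
    show ?thesis
    proof (cases "0 < t \<and> t + 1 < length U")
      case False
      then show ?thesis using Pair len a by (auto simp: corners_def shift_def)
    next
      case True
      then have U: "direction U i t = direction T i (if t \<le> a then t else Suc t)"
        "direction U i (t - 1) = direction T i (if t - 1 \<le> a then t - 1 else t)"
        using dir[of t i] dir[of "t - 1" i] by auto
      have U_corner: "(i, t) \<in> corners n U \<longleftrightarrow> i \<in> {1..n} \<and> direction U i (t - 1) \<noteq> direction U i t"
        using True by (simp add: corners_def)
      consider "t \<le> a" | "t = Suc a" | "t > Suc a" by linarith
      then show ?thesis
      proof cases
        case 1
        then have "t - 1 \<le> a" "t + 1 < length T" using a by auto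
        then show ?thesis
          unfolding Pair U_corner using U 1 True by (simp add: corners_def shift_def)
      next
        \<comment> \<open>All directions involved lie within the four equal rows and vanish, so
          there is no corner on either side.\<close>
        case 2
        then show ?thesis
          unfolding Pair U_corner using U dir0[of i] by (simp add: corners_def shift_def)
      next
        case 3
        then have "\<not> t \<le> a" "\<not> t - 1 \<le> a" "Suc t + 1 < length T" using True len by auto
        then show ?thesis
          unfolding Pair U_corner using U by (simp add: corners_def shift_def)
      qed
    qed
  qed
  have no_corner: "(i, Suc a) \<notin> corners n T" "(i, Suc (Suc a)) \<notin> corners n T" for i
    using dir0 by (auto simp: corners_def)
  have "c \<in> shift a ` corners n U" if c: "c \<in> corners n T" for c
  proof -
    obtain i t where it: "c = (i, t)" by force
    have "c = shift a (i, if t \<le> a then t else t - 1)"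
      using no_corner(1)[of i] c it by (cases "t = Suc a") (auto simp: shift_def)
    then show ?thesis using c corner_iff by (metis imageI)
  qed
  then have corners_eq: "corners n T = shift a ` corners n U"
    using corner_iff by auto
  have siteU: "site U (i, t) = (int (inv (T ! (if t \<le> a then t else Suc t)) i), int t)"
    if "(i, t) \<in> corners n U" for i t
    using that nth[of t] by (auto simp: site_def corners_def)
  \<comment> \<open>Positions are kept and time differences do not grow under the deletion, so edges
    of \<open>T\<close> pull back to \<open>U\<close>, and so does reachability from
    \<open>R\<close>.\<close>
  have edge: "(c, d) \<in> corner_edges n U"
    if cd: "c \<in> corners n U" "d \<in> corners n U" and e: "(shift a c, shift a d) \<in> corner_edges n T" for c d
  proof -
    obtain i t j s where *: "c = (i, t)" "d = (j, s)" by force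
    have "t \<noteq> Suc a" "s \<noteq> Suc a"
      using no_corner cd * corner_iff[of c] corner_iff[of d] by (auto simp: shift_def)
    then show ?thesis
      using e cd siteU[of i t] siteU[of j s]
      by (auto simp: * corner_edges_def infnorm_location_le_1_iff site_def shift_def split: if_splits)
  qed
  obtain R where R: "R \<subseteq> corners n T" "real (card R) \<le> K" "corners n T \<subseteq> (corner_edges n T)\<^sup>* `` R"
    using T by (auto simp: sparse_tangle_def)
  define R' where "R' = {c. shift a c \<in> R}"
  have R': "R' \<subseteq> corners n U" using R corner_iff by (auto simp: R'_def)
  have imR': "shift a ` R' = R" using R(1) corners_eq by (auto simp: R'_def)
  have path: "\<exists>c'. d = shift a c' \<and> c' \<in> corners n U \<and> (c, c') \<in> (corner_edges n U)\<^sup>*"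
    if "(shift a c, d) \<in> (corner_edges n T)\<^sup>*" "c \<in> corners n U" for c d
    using that(1)
  proof (induction rule: rtrancl_induct)
    case base
    then show ?case using that(2) by blast
  next
    case (step y z)
    then obtain y' where y': "y = shift a y'" "y' \<in> corners n U" "(c, y') \<in> (corner_edges n U)\<^sup>*"
      by auto
    have "z \<in> corners n T" using step by (auto simp: corner_edges_def)
    then obtain z' where z': "z = shift a z'" "z' \<in> corners n U" using corners_eq by auto
    then have "(y', z') \<in> corner_edges n U" using edge y' step by auto
    then have "(c, z') \<in> (corner_edges n U)\<^sup>*" using y'(3) by (rule rtrancl_into_rtrancl[rotated])
    then show ?case using z' by blast
  qed
  have "corners n U \<subseteq> (corner_edges n U)\<^sup>* `` R'"
  proof
    fix c assume c: "c \<in> corners n U"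
    then obtain r where "r \<in> R" "(r, shift a c) \<in> (corner_edges n T)\<^sup>*"
      using R(3) corners_eq by blast
    moreover from this obtain r' where "r = shift a r'" "r' \<in> R'" using imR' by auto
    ultimately obtain c' where "shift a c = shift a c'" "(r', c') \<in> (corner_edges n U)\<^sup>*"
      using path[of r' "shift a c"] R' by auto
    then show "c \<in> (corner_edges n U)\<^sup>* `` R'"
      using \<open>r' \<in> R'\<close> inj_shift by (auto dest: injD)
  qed
  moreover have "card R' = card R"
    using imR' card_image[OF inj_on_subset[OF inj_shift subset_UNIV], of a R'] by simp
  moreover have "card (corners n U) = card (corners n T)"
    unfolding corners_eq by (rule card_image[OF inj_on_subset[OF inj_shift subset_UNIV], symmetric])
  moreover have "tangle n U"
    unfolding tangle_def
  proof (intro conjI allI impI)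
    show "U \<noteq> []" using len a by auto
    show "\<forall>\<pi>\<in>set U. \<pi> permutes {1..n}"
      using tangT by (auto simp: U_def delete_row_def tangle_def dest: in_set_takeD in_set_dropD)
    show "adjacent n (U ! t) (U ! (t + 1))" if t: "t + 1 < length U" for t
    proof -
      have "\<bar>direction U i t\<bar> \<le> 1" if i: "i \<in> {1..n}" for i
      proof -
        have "(if t \<le> a then t else Suc t) + 1 < length T" using t len a by auto
        from direction_range[OF tangT this i] show ?thesis unfolding dir[OF t] by auto
      qed
      then show ?thesis unfolding adjacent_def direction_def by (simp add: abs_minus_commute)
    qed
  qed
  moreover have "hd U = id" using hdT by (cases T) (auto simp: U_def delete_row_def)
  moreover have "repeated_ends U"
    unfolding repeated_ends_def
  proof (intro conjI)
    show "2 \<le> length U" using len a by simp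
    show "U ! 0 = U ! 1" using nth[of 0] nth[of 1] len a eq repT
      by (cases a) (auto simp: repeated_ends_def numeral_2_eq_2)
    show "U ! (length U - 2) = U ! (length U - 1)"
    proof -
      \<comment> \<open>With \<open>m\<close> rows after the four equal ones, the last two rows of
        \<open>U\<close> have indices above \<open>a\<close>, hence are the last two rows of
        \<open>T\<close>.\<close>
      define m where "m = length T - (a + 4)"
      have m: "length T = a + 4 + m" using a by (simp add: m_def)
      have "U ! (a + 1 + m) = T ! (a + 2 + m)" "U ! (a + 2 + m) = T ! (a + 3 + m)"
        using nth[of "a + 1 + m"] nth[of "a + 2 + m"] len m by (simp_all add: eval_nat_numeral)
      moreover have "length T - 2 = a + 2 + m" "length T - 1 = a + 3 + m"
        "length U - 2 = a + 1 + m" "length U - 1 = a + 2 + m"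
        using m len by auto
      ultimately show ?thesis using repT by (simp add: repeated_ends_def)
    qed
  qed
  ultimately have "sparse_tangle n K M U"
    using T R(2) R' unfolding sparse_tangle_def by auto
  moreover have "last U = last T" using a by (simp add: U_def delete_row_def)
  ultimately show ?thesis by (simp add: U_def)
qed

lemma direction_constant:
  assumes "i \<in> {1..n}" "s + L < length T" "\<And>t. s < t \<Longrightarrow> t < s + L \<Longrightarrow> (i, t) \<notin> corners n T"
  shows "j < L \<Longrightarrow> direction T i (s + j) = direction T i s"
proof (induction j)
  case (Suc j)
  then show ?case using direction_step[of i "s + j" n T] assms by simp
qed simp

text \<open>Without corners, a path that moves leaves \<open>{1..n}\<close> within \<open>n\<close> steps.\<close>
lemma corner_free_constant:
  assumes T: "tangle n T" and sn: "s + n < length T"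
    and free: "\<And>i t. s < t \<Longrightarrow> t < s + n \<Longrightarrow> (i, t) \<notin> corners n T"
  shows "k \<le> n \<Longrightarrow> T ! (s + k) = T ! s"
proof -
  have dir: "direction T i (s + j) = 0" if i: "i \<in> {1..n}" and j: "j < n" for i j
  proof -
    define d where "d = direction T i s"
    have const: "direction T i (s + j) = d" if "j < n" for j
      using direction_constant[OF i sn free that] by (simp add: d_def)
    have pos: "k \<le> n \<Longrightarrow> int (inv (T ! (s + k)) i) = int (inv (T ! s) i) + int k * d" for k
    proof (induction k)
      case (Suc k)
      then show ?case using const[of k] by (simp add: direction_def algebra_simps)
    qed simp
    have "inv (T ! s) i \<in> {1..n}" "inv (T ! (s + n)) i \<in> {1..n}"
      using inv_in_range_iff[OF tangle_permutes[OF T]] sn i by auto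
    \<comment> \<open>Two positions in \<open>{1..n}\<close> differ by less than \<open>n\<close>,
      while \<open>n\<close> steps with constant direction \<open>d\<close> give a displacement of
      \<open>n * d\<close>.\<close>
    then have "\<bar>int n * d\<bar> < int n" using pos[of n] by auto
    then have "int n * \<bar>d\<bar> < int n * 1" by (simp add: abs_mult)
    then have "\<bar>d\<bar> < 1" using i by (subst (asm) mult_less_cancel_left_pos) auto
    then have "d = 0" by simp
    then show ?thesis using const j by simp
  qed
  show "k \<le> n \<Longrightarrow> T ! (s + k) = T ! s"
  proof (induction k)
    case (Suc k)
    then show ?case
      using direction_eq_0_iff[OF T, of "s + k"] dir[of _ k] sn by auto
  qed simp
qed

text \<open>Cut the tangle into blocks of \<open>n\<close> steps. A block without an interior corner
  would be constant and, as \<open>n \<ge> 3\<close>, contain four equal rows. So distinct blocks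
  provide distinct corners.\<close>

lemma length_le_if_compact:
  assumes T: "tangle n T" and n: "3 \<le> n"
    and compact: "\<And>a. a + 3 < length T \<Longrightarrow>
      \<not> (T ! Suc a = T ! a \<and> T ! Suc (Suc a) = T ! a \<and> T ! Suc (Suc (Suc a)) = T ! a)"
  shows "length T \<le> n * (card (corners n T) + 1)"
proof -
  let ?B = "(length T - 1) div n"
  have "\<exists>c. c \<in> corners n T \<and> b * n < snd c \<and> snd c < b * n + n" if "b < ?B" for b
  proof (rule ccontr)
    assume none: "\<not> ?thesis"
    have "Suc b * n \<le> ?B * n" using that by (intro mult_le_mono1) simp
    also have "\<dots> \<le> length T - 1" by simp
    finally have len: "b * n + n < length T" using T by (cases T) (auto simp: tangle_def)
    have "T ! (b * n + k) = T ! (b * n)" if "k \<le> n" for k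
      using corner_free_constant[OF T len _ that] none by fastforce
    from this[of 1] this[of 2] this[of 3] show False
      using compact[of "b * n"] n len by (simp add: numeral_2_eq_2 numeral_3_eq_3)
  qed
  then obtain f where f: "b < ?B \<Longrightarrow> f b \<in> corners n T \<and> b * n < snd (f b) \<and> snd (f b) < b * n + n" for b
    by metis
  have "snd (f b) div n = b" if "b < ?B" for b
    using f[OF that] by (intro div_nat_eqI) (auto simp: mult.commute)
  then have "inj_on f {..<?B}"
    by (metis inj_onI lessThan_iff)
  then have "card {..<?B} \<le> card (corners n T)"
    by (rule card_inj_on_le) (use f finite_corners in auto)
  then have "?B < card (corners n T) + 1" by simp
  then have "length T - 1 < (card (corners n T) + 1) * n"
    using n by (simp add: div_less_iff_less_mult)
  then show ?thesis by (simp add: mult.commute)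
qed

text \<open>Among the sparse tangles with the same last permutation, one of minimal length has no
  four equal consecutive rows, since one of these could be deleted.\<close>

lemma exists_short_sparse_tangle:
  assumes "sparse_tangle n K M T" "3 \<le> n"
  shows "\<exists>U. sparse_tangle n K M U \<and> last U = last T \<and> length U \<le> n * (card (corners n U) + 1)"
proof -
  let ?P = "\<lambda>U. sparse_tangle n K M U \<and> last U = last T"
  obtain U where U: "?P U" "\<And>V. ?P V \<Longrightarrow> length U \<le> length V"
    using ex_has_least_nat[of ?P T length] assms by auto
  have "length U \<le> n * (card (corners n U) + 1)"
  proof (rule length_le_if_compact)
    show "\<not> (U ! Suc a = U ! a \<and> U ! Suc (Suc a) = U ! a \<and> U ! Suc (Suc (Suc a)) = U ! a)"
      if a: "a + 3 < length U" for a
    proof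
      assume "U ! Suc a = U ! a \<and> U ! Suc (Suc a) = U ! a \<and> U ! Suc (Suc (Suc a)) = U ! a"
      then have "?P (delete_row a U)" using sparse_delete_row[of n K M U a] U(1) a by auto
      then show False using U(2) a by (force simp: length_delete_row)
    qed
  qed (use U assms in \<open>auto simp: sparse_tangle_def\<close>)
  then show ?thesis using U by auto
qed

subsection \<open>Encoding and counting\<close>

text \<open>
  The set \<open>A\<close> holds the points found but not yet processed.  Each letter of the word
  gives the label of the next processed point and the offsets of the points found from it.
\<close>
fun explore :: "('l \<times> 'a::ab_group_add set) list \<Rightarrow> 'a set \<Rightarrow> ('a \<times> 'l) set" where
  "explore [] A = {}"
| "explore ((l, S) # w) A =
     (if A = {} then {}
      else let a = (SOME a. a \<in> A) in insert (a, l) (explore w (A - {a} \<union> (+) a ` S)))"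

lemma explore_empty [simp]: "explore w {} = {}"
  by (cases w) auto

text \<open>Induction on the number of points left. Reachability is expressed by closed sets because
  this form survives the removal of a processed point \<open>a\<close>: a set closed in
  \<open>C - {a}\<close> that contains the new pending points becomes closed in \<open>C\<close>
  once \<open>a\<close> is added.\<close>

lemma explore_complete:
  assumes "finite C" "A \<subseteq> C" "card C \<le> L"
    and "\<And>B. A \<subseteq> B \<Longrightarrow> B \<subseteq> C \<Longrightarrow> (\<forall>b\<in>B. \<forall>c\<in>C. c - b \<in> Q \<longrightarrow> c \<in> B) \<Longrightarrow> B = C"
    and "l ` C \<subseteq> Y" "Y \<noteq> {}"
  shows "\<exists>w. length w = L \<and> set w \<subseteq> Y \<times> Pow Q \<and> explore w A = (\<lambda>c. (c, l c)) ` C"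
  using assms(1-5)
proof (induction L arbitrary: C A)
  case 0
  then show ?case by auto
next
  case (Suc L)
  show ?case
  proof (cases "A = {}")
    case True
    then have "C = {}" using Suc.prems(4)[of "{}"] by simp
    moreover obtain y where "y \<in> Y" using assms(6) by auto
    ultimately show ?thesis using True
      \<comment> \<open>With no pending point left, \<open>explore\<close> ignores the rest of the
        word, so any padding to the exact length serves.\<close>
      by (intro exI[of _ "replicate (Suc L) (y, {})"]) auto
  next
    case False
    \<comment> \<open>The same choice as in \<open>explore\<close>, so the word is written in the
      order in which it is decoded.\<close>
    define a where "a = (SOME a. a \<in> A)"
    have "a \<in> A" using False by (simp add: a_def some_in_eq)
    then have a: "a \<in> A" "a \<in> C" using Suc.prems(2) by auto
    \<comment> \<open>Processed points have left \<open>C\<close>, so these offsets never lead back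
      to them.\<close>
    define S where "S = {q \<in> Q. a + q \<in> C - {a}}"
    define A' where "A' = A - {a} \<union> (+) a ` S"
    have "\<exists>w. length w = L \<and> set w \<subseteq> Y \<times> Pow Q \<and> explore w A' = (\<lambda>c. (c, l c)) ` (C - {a})"
    proof (rule Suc.IH)
      show "A' \<subseteq> C - {a}" using Suc.prems(2) by (auto simp: A'_def S_def)
      show "card (C - {a}) \<le> L" using Suc.prems a by simp
      show "B = C - {a}" if B: "A' \<subseteq> B" "B \<subseteq> C - {a}"
        "\<forall>b\<in>B. \<forall>c\<in>C - {a}. c - b \<in> Q \<longrightarrow> c \<in> B" for B
      proof -
        have "c \<in> insert a B" if "c \<in> C" "c - a \<in> Q" for c
        proof (cases "c = a")
          case False
          then have "a + (c - a) \<in> (+) a ` S" using that by (intro imageI) (auto simp: S_def)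
          then show ?thesis using B(1) by (auto simp: A'_def)
        qed auto
        then have "insert a B = C"
          using B a by (intro Suc.prems(4)) (auto simp: A'_def)
        then show ?thesis using B(2) by auto
      qed
    qed (use Suc.prems in auto)
    then obtain w where w: "length w = L" "set w \<subseteq> Y \<times> Pow Q"
      "explore w A' = (\<lambda>c. (c, l c)) ` (C - {a})" by auto
    have "explore ((l a, S) # w) A = insert (a, l a) (explore w A')"
      using False by (simp add: Let_def A'_def a_def[symmetric])
    also have "\<dots> = (\<lambda>c. (c, l c)) ` C" using w(3) a(2) by auto
    finally show ?thesis using w a Suc.prems(5)
      by (intro exI[of _ "(l a, S) # w"]) (auto simp: S_def)
  qed
qed

section \<open>Numerical bounds\<close>

lemma card_bounded_subsets_le:
  fixes K :: real
  assumes fin: "finite P" and K: "0 < K" "K \<le> real (card P)"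
  shows "real (card {R. R \<subseteq> P \<and> real (card R) \<le> K}) \<le> (exp 1 * real (card P) / K) powr K"
proof -
  define p where "p = real (card P)"
  \<comment> \<open>With this weight \<open>exp x ^ card P\<close> is exactly \<open>exp K\<close>;
    the hypothesis \<open>K \<le> card P\<close> gives \<open>x \<le> 1\<close>.\<close>
  define x where "x = K / p"
  have p: "p > 0" using K by (simp add: p_def)
  have x: "0 < x" "x \<le> 1" using K p by (auto simp: x_def p_def)
  let ?F = "{R. R \<subseteq> P \<and> real (card R) \<le> K}"
  \<comment> \<open>exponential tilting: weight \<open>R\<close> by \<open>x powr (card R - K) \<ge> 1\<close>, then sum over all subsets\<close>
  have "real (card ?F) = (\<Sum>R\<in>?F. 1)" by simp
  also have "\<dots> \<le> (\<Sum>R\<in>?F. x powr (real (card R) - K))"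
    using x by (intro sum_mono) (simp add: powr_def mult_nonpos_nonpos)
  also have "\<dots> \<le> (\<Sum>R\<in>Pow P. x powr (real (card R) - K))"
    by (rule sum_mono2) (use fin in auto)
  also have "\<dots> = (\<Sum>R\<in>Pow P. x ^ card R) * x powr (-K)"
    using x unfolding sum_distrib_right
    by (intro sum.cong) (simp_all add: powr_diff powr_minus powr_realpow divide_inverse)
  \<comment> \<open>Expanding a product of \<open>card P\<close> factors \<open>x + 1\<close> yields
    one term for each subset.\<close>
  also have "(\<Sum>R\<in>Pow P. x ^ card R) = (1 + x) ^ card P"
    using prod_add[OF fin, of "\<lambda>_. x" "\<lambda>_. 1"] by (simp add: add.commute)
  also have "\<dots> \<le> exp x ^ card P"
    using x by (intro power_mono) auto
  also have "\<dots> = exp K"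
    using p by (simp add: exp_of_nat_mult[symmetric] x_def p_def)
  also have "exp K * x powr (-K) = (exp 1 * p / K) powr K"
    using p K by (simp add: x_def powr_def ln_mult ln_div algebra_simps flip: exp_add)
  finally show ?thesis using x by (simp add: p_def)
qed

text \<open>\<open>n^n / n!\<close> is a single term of the exponential series at
  \<open>n\<close>.\<close>

lemma power_self_le_exp_fact: "real n ^ n \<le> exp (real n) * fact n"
proof -
  have "(\<Sum>k\<in>{n}. inverse (fact k) *\<^sub>R real n ^ k) \<le> (\<Sum>k. inverse (fact k) *\<^sub>R real n ^ k)"
    by (rule sum_le_suminf[OF summable_exp_generic]) auto
  then show ?thesis by (simp add: exp_def field_simps)
qed

text \<open>Take logarithms and divide by \<open>n\<close>; let \<open>y = ln n\<close> and
  \<open>z = \<theta> y\<close>. The first factor costs at most \<open>y - 2z + z/12 + 1\<close>,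
  the second at most \<open>(275/216) z\<close>. Since \<open>n^n \<le> e^n n!\<close>, a total of
  \<open>y - 2\<close> is affordable, so \<open>(139/216) z \<ge> 3\<close> suffices.\<close>

lemma counting_estimate:
  fixes \<theta> :: real and n :: nat
  assumes \<theta>: "0 < \<theta>" "\<theta> < 1/2" and n: "0 < n" "real n > \<theta> powr (- 8 / \<theta>)"
  defines "K \<equiv> (1/2 - \<theta>) * real n" and "M \<equiv> 1/6 * \<theta> * real n * ln (real n)"
  shows "(exp 1 * (real n ^ 2 * (M + 1)) / K) powr K * 1536 powr M \<le> exp (- real n) * fact n"
proof -
  define a where "a = 1/2 - \<theta>"
  define y where "y = ln (real n)"
  define z where "z = \<theta> * y"
  have a: "0 < a" "a \<le> 1/2" using \<theta> by (auto simp: a_def)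
  \<comment> \<open>The lower bound on \<open>n\<close> enters here:
    \<open>z > -8 ln \<theta> \<ge> 8 ln 2 \<ge> 16/3\<close>.\<close>
  have "ln (\<theta> powr (- 8 / \<theta>)) < y"
    unfolding y_def using n \<theta> by (subst ln_less_cancel_iff) auto
  then have "8 * - ln \<theta> < z"
    using \<theta> by (simp add: ln_powr z_def field_simps)
  moreover have "ln \<theta> \<le> ln (1/2)" using \<theta> by (subst ln_le_cancel_iff) auto
  ultimately have z: "z \<ge> 16/3" using ln2_ge_two_thirds by (simp add: ln_div)
  have K: "K = a * real n" "K > 0" using a n by (auto simp: K_def a_def)
  have M: "M = z / 6 * real n" by (simp add: M_def z_def y_def)
  have "n \<ge> 1" using n by simp
  then have "M + 1 \<le> (z / 6 + 1) * real n" using M by (simp add: algebra_simps)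
  have "M \<ge> 0" using z unfolding M by (intro mult_nonneg_nonneg) auto
  then have M0: "M + 1 > 0" by simp
  have "ln (M + 1) \<le> ln ((z / 6 + 1) * real n)"
    using M0 \<open>M + 1 \<le> _\<close> n z by (subst ln_le_cancel_iff) auto
  also have "\<dots> = ln (z / 6 + 1) + y" using n z by (simp add: ln_mult y_def)
  also have "ln (z / 6 + 1) \<le> z / 6" using ln_add_one_self_le_self[of "z/6"] z by (simp add: add.commute)
  finally have lnM: "ln (M + 1) \<le> z / 6 + y" by simp
  \<comment> \<open>Although \<open>1/a\<close> is unbounded as \<open>\<theta>\<close> approaches
    1/2, multiplied by \<open>K = a n\<close> it contributes only \<open>n\<close>.\<close>
  have lna: "- ln a \<le> 1 / a - 1"
    using ln_le_minus_one[of "1 / a"] a by (simp add: ln_div)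
  have "ln (exp 1 * (real n ^ 2 * (M + 1)) / K) = 1 + 2 * y + ln (M + 1) - ln a - y"
    using n a M0 by (simp add: K(1) ln_mult ln_div ln_realpow y_def)
  also have "\<dots> \<le> 2 * y + z / 6 + 1 / a" using lnM lna by simp
  finally have "K * ln (exp 1 * (real n ^ 2 * (M + 1)) / K) \<le> K * (2 * y + z / 6 + 1 / a)"
    using K(2) by (intro mult_left_mono) auto
  also have "\<dots> = real n * (2 * a * y + a * z / 6 + 1)" using a by (simp add: K field_simps)
  also have "\<dots> \<le> real n * (y - 2 * z + z / 12 + 1)"
    using a z by (intro mult_left_mono) (auto simp: a_def z_def algebra_simps)
  finally have 1: "K * ln (exp 1 * (real n ^ 2 * (M + 1)) / K) \<le> real n * (y - 2 * z + z / 12 + 1)" .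
  \<comment> \<open>Here \<open>1536 = 3 * 2^9\<close>, from 3 labels and the subsets of 9 offsets,
    is rounded up to \<open>2^11\<close>.\<close>
  have "ln (1536::real) \<le> ln (2 ^ 11)" by (subst ln_le_cancel_iff) auto
  also have "\<dots> \<le> 11 * (25/36)" using ln2_le_25_over_36 by (subst ln_realpow) auto
  finally have "M * ln 1536 \<le> M * (275/36)" using M0 \<open>M \<ge> 0\<close> by (intro mult_left_mono) auto
  then have "K * ln (exp 1 * (real n ^ 2 * (M + 1)) / K) + M * ln 1536
      \<le> real n * (y - 2 * z + z / 12 + 1 + z / 6 * (275/36))"
    using 1 by (simp add: M algebra_simps)
  also have "\<dots> \<le> real n * (y - 2)" using z by (intro mult_left_mono) auto
  finally have "(exp 1 * (real n ^ 2 * (M + 1)) / K) powr K * 1536 powr M \<le> exp (real n * (y - 2))"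
    using K M0 n by (simp add: powr_def exp_add[symmetric])
  also have "\<dots> = exp (- real n) * (exp (- real n) * real n ^ n)"
  proof -
    have "real n ^ n = exp (real n * y)"
      using n by (simp add: exp_of_nat_mult y_def)
    moreover have "real n * (y - 2) = - real n + (- real n + real n * y)"
      by (simp add: algebra_simps)
    ultimately show ?thesis by (simp only: exp_add)
  qed
  also have "\<dots> \<le> exp (- real n) * (exp (- real n) * (exp (real n) * fact n))"
    by (intro mult_left_mono power_self_le_exp_fact) auto
  also have "\<dots> = exp (- real n) * fact n" by (simp add: exp_minus)
  finally show ?thesis .
qed

section \<open>Codes of sparse tangles\<close>

lemma sparse_tangle_if_few:
  assumes T: "tangle n T" "hd T = id" "repeated_ends T"
    and K: "real (card (clusters n T)) \<le> K" and M: "real (num_corners n T) \<le> M"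
  shows "sparse_tangle n K M T"
proof -
  define rep where "rep = (\<lambda>X :: (nat \<times> nat) set. SOME c. c \<in> X)"
  have rep: "rep X \<in> X" if "X \<in> clusters n T" for X
    using that by (auto simp: clusters_def quotient_def rep_def intro: someI)
  have "corners n T \<subseteq> (corner_edges n T)\<^sup>* `` (rep ` clusters n T)"
  proof
    fix c assume c: "c \<in> corners n T"
    define X where "X = (corner_edges n T)\<^sup>* `` {c}"
    have X: "X \<in> clusters n T" using c by (auto simp: X_def clusters_def intro: quotientI)
    then have "(c, rep X) \<in> (corner_edges n T)\<^sup>*" using rep by (auto simp: X_def)
    then have "(rep X, c) \<in> (corner_edges n T)\<^sup>*"
      using equiv_corner_edges by (meson equivE symE)
    then show "c \<in> (corner_edges n T)\<^sup>* `` (rep ` clusters n T)" using X by auto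
  qed
  moreover have "rep ` clusters n T \<subseteq> corners n T"
    using rep clusters_subset by blast
  moreover have "finite (clusters n T)"
    using clusters_subset finite_corners by (metis PowI finite_Pow_iff finite_subset subsetI)
  then have "real (card (rep ` clusters n T)) \<le> K"
    using K card_image_le[of "clusters n T" rep] by linarith
  \<comment> \<open>Every corner has multiplicity at least 1.\<close>
  moreover have "card (corners n T) \<le> num_corners n T"
  proof -
    have "(\<Sum>c\<in>corners n T. 1) \<le> num_corners n T"
      unfolding num_corners_def
      by (intro sum_mono) (auto simp: multiplicity_of_corner_def)
    then show ?thesis by simp
  qed
  then have "real (card (corners n T)) \<le> M" using M by linarith
  ultimately show ?thesis using T unfolding sparse_tangle_def by blast
qed

text \<open>Turns reachability in the corner graph into the closed-set hypothesis of
  \<open>explore_complete\<close>.\<close>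

lemma seeds_reach_all_sites:
  assumes R: "corners n T \<subseteq> (corner_edges n T)\<^sup>* `` R" "R \<subseteq> corners n T"
    and B: "site T ` R \<subseteq> B" "B \<subseteq> site T ` corners n T"
      "\<forall>b\<in>B. \<forall>c\<in>site T ` corners n T. c - b \<in> {-1..1} \<times> {-1..1} \<longrightarrow> c \<in> B"
  shows "B = site T ` corners n T"
proof -
  have "site T d \<in> B" if "(c, d) \<in> (corner_edges n T)\<^sup>*" "site T c \<in> B" for c d
    using that
  proof (induction rule: rtrancl_induct)
    case (step y z)
    then have "infnorm (location T z - location T y) \<le> 1" "z \<in> corners n T"
      by (auto simp: corner_edges_def infnorm_sub)
    then show ?case using B(3) step by (auto simp: infnorm_location_le_1_iff)
  qed
  then show ?thesis using R B by blast
qed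

lemma sparse_tangle_code:
  assumes T: "sparse_tangle n K M T" and L: "M < real L + 1"
    and P: "site T ` corners n T \<subseteq> P"
  shows "\<exists>R w. R \<subseteq> P \<and> real (card R) \<le> K \<and> length w = L \<and>
    set w \<subseteq> {-1, 0, 1} \<times> Pow ({-1..1} \<times> {-1..1}) \<and> corner_labels n T = explore w R"
proof -
  have tang: "tangle n T" using T by (simp add: sparse_tangle_def)
  obtain R where R: "R \<subseteq> corners n T" "real (card R) \<le> K" "corners n T \<subseteq> (corner_edges n T)\<^sup>* `` R"
    using T by (auto simp: sparse_tangle_def)
  have inj: "inj_on (site T) (corners n T)"
    using site_inject[OF tang] by (auto intro: inj_onI)
  \<comment> \<open>The label as a function of the site, well defined since a site determines its
    corner.\<close>
  define l where "l = (\<lambda>p. case_prod (direction T) (inv_into (corners n T) (site T) p))"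
  have l: "l (site T c) = case_prod (direction T) c" if "c \<in> corners n T" for c
    using inj that by (simp add: l_def)
  have "\<exists>w. length w = L \<and> set w \<subseteq> {-1, 0, 1} \<times> Pow ({-1..1} \<times> {-1..1}) \<and>
      explore w (site T ` R) = (\<lambda>p. (p, l p)) ` site T ` corners n T"
  proof (rule explore_complete)
    have "real (card (corners n T)) < real L + 1" using T L by (auto simp: sparse_tangle_def)
    then show "card (site T ` corners n T) \<le> L"
      using card_image_le[OF finite_corners, of "site T" n T] by linarith
    show "l ` site T ` corners n T \<subseteq> {-1, 0, 1}"
      using l direction_range[OF tang] by (fastforce simp: corners_def)
    show "B = site T ` corners n T"
      if "site T ` R \<subseteq> B" "B \<subseteq> site T ` corners n T"
        "\<forall>b\<in>B. \<forall>c\<in>site T ` corners n T. c - b \<in> {-1..1} \<times> {-1..1} \<longrightarrow> c \<in> B" for B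
      using seeds_reach_all_sites[OF R(3,1) that] .
  qed (use R(1) finite_corners in auto)
  then obtain w where w: "length w = L" "set w \<subseteq> {-1, 0, 1} \<times> Pow ({-1..1} \<times> {-1..1})"
    "explore w (site T ` R) = (\<lambda>p. (p, l p)) ` site T ` corners n T" by auto
  have "corner_labels n T = explore w (site T ` R)"
    unfolding w(3) corner_labels_def image_image using l by (intro image_cong) auto
  moreover have "card (site T ` R) \<le> card R"
    by (rule card_image_le) (use R(1) finite_corners finite_subset in blast)
  moreover have "site T ` R \<subseteq> P" using R(1) P by auto
  ultimately show ?thesis using w R(2) by (intro exI[of _ "site T ` R"] exI[of _ w]) auto
qed

text \<open>A chain of surjections: codes yield the label sets of short tangles, and each label set
  yields one last permutation. So the count is at most the number of words times the number of sets
  of representatives.\<close>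

lemma card_sparse_permutations_le:
  fixes K M :: real
  assumes n: "3 \<le> n" and K: "0 < K" "K \<le> real n" and M: "0 \<le> M"
  shows "real (card {last T |T. sparse_tangle n K M T})
    \<le> (exp 1 * (real n ^ 2 * (M + 1)) / K) powr K * 1536 powr M"
proof -
  define L where "L = nat \<lfloor>M\<rfloor>"
  \<comment> \<open>A box containing all corner sites of short tangles; times start at 1 as no
    corner has time index 0.\<close>
  define P :: "(int \<times> int) set" where "P = {1..int n} \<times> {1..int (n * (L + 1))}"
  define S where "S = {R. R \<subseteq> P \<and> real (card R) \<le> K}"
  define W :: "(int \<times> (int \<times> int) set) list set" where
    "W = {w. set w \<subseteq> {-1, 0, 1} \<times> Pow ({-1..1} \<times> {-1..1}) \<and> length w = L}"
  define short where "short = {U. sparse_tangle n K M U \<and> length U \<le> n * (L + 1)}"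
  have L: "real L \<le> M" "M < real L + 1" using M by (auto simp: L_def)
  have card_P: "real (card P) = real n ^ 2 * (real L + 1)"
    by (simp add: P_def card_cartesian_product power2_eq_square algebra_simps)
  have finP: "finite P" by (simp add: P_def)
  have finS: "finite S" using finP by (auto simp: S_def intro: finite_subset[of _ "Pow P"])
  have finW: "finite W" unfolding W_def by (rule finite_lists_length_eq) auto
  have card_W: "card W = 1536 ^ L"
    unfolding W_def by (subst card_lists_length_eq) (auto simp: card_cartesian_product card_Pow)
  have labels: "corner_labels n ` short \<subseteq> case_prod explore ` (W \<times> S)"
  proof
    fix D assume "D \<in> corner_labels n ` short"
    then obtain U where U: "D = corner_labels n U" "sparse_tangle n K M U" "length U \<le> n * (L + 1)"
      by (auto simp: short_def)
    have "site U c \<in> P" if corner: "c \<in> corners n U" for c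
    proof -
      obtain i t where c: "c = (i, t)" "i \<in> {1..n}" "0 < t" "t < length U"
        using corner by (cases c) (auto simp: corners_def)
      then have "inv (U ! t) i \<in> {1..n}"
        using inv_in_range_iff[OF tangle_permutes[of n U t]] U(2) by (auto simp: sparse_tangle_def)
      moreover have "int t \<le> int (n * (L + 1))" using c U(3) by (intro of_nat_mono) simp
      ultimately show ?thesis using c by (simp add: P_def site_def)
    qed
    then have "site U ` corners n U \<subseteq> P" by auto
    from sparse_tangle_code[OF U(2) L(2) this] show "D \<in> case_prod explore ` (W \<times> S)"
      unfolding U(1) by (force simp: W_def S_def)
  qed
  have "{last T |T. sparse_tangle n K M T} \<subseteq> last ` short"
  proof clarify
    fix T assume "sparse_tangle n K M T"
    then obtain U where U: "sparse_tangle n K M U" "last U = last T"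
      "length U \<le> n * (card (corners n U) + 1)"
      using exists_short_sparse_tangle n by blast
    have "real (card (corners n U)) < real L + 1" using U(1) L by (auto simp: sparse_tangle_def)
    then have "card (corners n U) \<le> L" by linarith
    then have "length U \<le> n * (L + 1)" using U(3) by (meson add_le_mono1 le_trans mult_le_mono2)
    then have "U \<in> short" using U(1) by (simp add: short_def)
    then show "last T \<in> last ` short" using U(2) by (metis imageI)
  qed
  \<comment> \<open>By \<open>corner_labels_determine\<close>, the last permutation does not depend
    on which short tangle with the given labels is chosen.\<close>
  also have "\<dots> \<subseteq> (\<lambda>D. last (SOME U. U \<in> short \<and> corner_labels n U = D)) ` corner_labels n ` short"
  proof clarify
    fix U assume U: "U \<in> short"
    define V where "V = (SOME V. V \<in> short \<and> corner_labels n V = corner_labels n U)"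
    have "V \<in> short \<and> corner_labels n V = corner_labels n U"
      unfolding V_def by (rule someI[of _ U]) (use U in auto)
    then have "last U = last V"
      using U by (intro corner_labels_determine[of n]) (auto simp: short_def sparse_tangle_def)
    then show "last U \<in> (\<lambda>D. last (SOME U. U \<in> short \<and> corner_labels n U = D)) ` corner_labels n ` short"
      using U unfolding V_def by blast
  qed
  finally have "card {last T |T. sparse_tangle n K M T} \<le> card (corner_labels n ` short)"
    using finite_subset[OF labels] finS finW by (intro surj_card_le) auto
  also have "\<dots> \<le> card (case_prod explore ` (W \<times> S))"
    using labels finS finW by (intro card_mono) auto
  also have "\<dots> \<le> card (W \<times> S)"
    using finS finW by (intro card_image_le) auto
  also have "\<dots> = 1536 ^ L * card S" by (simp add: card_cartesian_product card_W)
  finally have "real (card {last T |T. sparse_tangle n K M T}) \<le> real (1536 ^ L * card S)"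
    by (rule of_nat_mono)
  also have "\<dots> = real (card S) * 1536 powr real L" by (simp add: powr_realpow)
  also have "\<dots> \<le> (exp 1 * (real n ^ 2 * (M + 1)) / K) powr K * 1536 powr M"
  proof (rule mult_mono)
    have "real n * 1 \<le> real n * (real n * (real L + 1))"
      using n by (intro mult_left_mono) (auto intro: order_trans[OF _ mult_mono[of 1 _ 1]])
    then have "K \<le> real (card P)"
      using K(2) unfolding card_P power2_eq_square mult.assoc by linarith
    then have "real (card S) \<le> (exp 1 * real (card P) / K) powr K"
      unfolding S_def by (rule card_bounded_subsets_le[OF finP K(1)])
    also have "\<dots> \<le> (exp 1 * (real n ^ 2 * (M + 1)) / K) powr K"
      unfolding card_P using K L by (intro powr_mono2 divide_right_mono mult_left_mono) auto
    finally show "real (card S) \<le> (exp 1 * (real n ^ 2 * (M + 1)) / K) powr K" .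
  qed (use L in auto)
  finally show ?thesis .
qed

theorem theorem3:
  fixes \<theta> :: real and n :: nat
  assumes "0 < \<theta>" and "\<theta> < 1/2"
    and "0 < n" and "real n > \<theta> powr (- 8 / \<theta>)"
  shows "real (card {\<pi>. \<pi> permutes {1..n} \<and>
            (\<forall>T. performs n T \<pi> \<and> repeated_ends T \<longrightarrow>
               real (card (clusters n T)) \<ge> (1/2 - \<theta>) * real n \<or>
               real (num_corners n T) \<ge> 1/6 * \<theta> * real n * ln (real n))})
         \<ge> (1 - exp (- real n)) * fact n"
proof -
  define K where "K = (1/2 - \<theta>) * real n"
  define M where "M = 1/6 * \<theta> * real n * ln (real n)"
  let ?good = "{\<pi>. \<pi> permutes {1..n} \<and>
            (\<forall>T. performs n T \<pi> \<and> repeated_ends T \<longrightarrow>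
               real (card (clusters n T)) \<ge> (1/2 - \<theta>) * real n \<or>
               real (num_corners n T) \<ge> 1/6 * \<theta> * real n * ln (real n))}"
  let ?sparse = "{last T |T. sparse_tangle n K M T}"
  let ?perms = "{\<pi>. \<pi> permutes {1..n}}"
  \<comment> \<open>The threshold for \<open>n\<close> is at least \<open>2^2\<close>, because
    \<open>1/\<theta> \<ge> 2\<close>; this gives the \<open>n \<ge> 3\<close> used in
    shortening.\<close>
  have "(2::real) powr 2 \<le> inverse \<theta> powr 2"
    using assms by (intro powr_mono2) (auto simp: field_simps)
  also have "\<dots> \<le> inverse \<theta> powr (8 / \<theta>)"
    using assms by (intro powr_mono) (auto simp: field_simps)
  also have "\<dots> = \<theta> powr (- 8 / \<theta>)" using assms by (simp add: powr_minus powr_def ln_inverse)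
  finally have n: "3 \<le> n" using assms by simp
  have K: "0 < K" "K \<le> real n" using assms by (auto simp: K_def algebra_simps)
  have M: "0 \<le> M" using assms n by (auto simp: M_def)
  have sparse_perms: "?sparse \<subseteq> ?perms"
    by (auto simp: sparse_tangle_def tangle_def)
  \<comment> \<open>A permutation outside \<open>?good\<close> is performed by a tangle with both
    counts below their bounds, which is sparse.\<close>
  have "?perms \<subseteq> ?good \<union> ?sparse"
  proof
    fix \<pi> assume \<pi>: "\<pi> \<in> ?perms"
    show "\<pi> \<in> ?good \<union> ?sparse"
    proof (cases "\<pi> \<in> ?good")
      case False
      then obtain T where "performs n T \<pi>" "repeated_ends T"
        "real (card (clusters n T)) \<le> K" "real (num_corners n T) \<le> M"
        using \<pi> unfolding K_def M_def by force
      then show ?thesis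
        using sparse_tangle_if_few[of n T K M] by (auto simp: performs_def)
    qed auto
  qed
  moreover have fin: "finite ?perms"
    by (rule finite_permutations) simp
  moreover have "finite (?good \<union> ?sparse)"
    using sparse_perms by (intro finite_subset[OF _ fin]) auto
  ultimately have "card ?perms \<le> card (?good \<union> ?sparse)"
    by (intro card_mono)
  also have "\<dots> \<le> card ?good + card ?sparse" by (rule card_Un_le)
  finally have "fact n \<le> card ?good + card ?sparse"
    using card_permutations[of "{1..n}" n] by simp
  then have "real (fact n) \<le> real (card ?good + card ?sparse)"
    by (rule of_nat_mono)
  then have "fact n \<le> real (card ?good) + real (card ?sparse)"
    by (simp only: of_nat_add of_nat_fact)
  moreover have "real (card ?sparse) \<le> exp (- real n) * fact n"
    using card_sparse_permutations_le[OF n K M] counting_estimate[OF assms]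
    unfolding K_def M_def by linarith
  ultimately show ?thesis by (simp add: algebra_simps)
qed

end
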